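(* Let $X$ and $Y$ be $L$-spaces, $(T,r)$ a metric compact, $\omega$ a modulus of continuity, $\lambda\in\mathcal H(X,Y)$, $\varphi\in\mathcal M(T)$, let $\chi\in B(T,\mathbb R)$ be non-negative with $\varphi(\chi)>0$, $\Lambda\in\mathcal L(\lambda,\varphi)$ and $t\in T$. Then $$\sup_{f\in H^\omega(T,X),\ \Lambda(\chi f)=\theta}h_Y(\lambda(f(t)),\theta)\le\tfrac{1}{\varphi(\chi)}\varphi\big(\omega(r(t,\cdot))\chi(\cdot)\big).$$ If, moreover, $X$ is isotropic, $\varphi$ is $\chi$-averaging, $\Lambda(u_x)=\lambda(x)\varphi(u_+)+\lambda(x')\varphi(u_-)$ for all $x\in X^{\rm c}\cap X^{\rm inv}$ and $u\in B(T,\mathbb R)$, and the set $$\tilde X=\{x\in X^{\rm inv}\cap X^{\rm c}:\ \lambda(x)\in Y^{\rm inv}\cap Y^{\rm c},\ \lambda(x')=(\lambda(x))'\}$$ contains a $\lambda$-extremal sequence, then the inequality becomes an equality.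
   Context: Semilinear space: a set $X$ with addition and multiplication by reals such that for all $x,y,z\in X$, $\alpha,\beta\in\mathbb R$: $x+y=y+x$; $x+(y+z)=(x+y)+z$; there is $\theta$ with $x+\theta=x$; $\alpha(x+y)=\alpha x+\alpha y$; $\alpha(\beta x)=(\alpha\beta)x$; $1\cdot x=x$, $0\cdot x=\theta$. $x$ is convex if $(\alpha+\beta)x=\alpha x+\beta x$ for all $\alpha,\beta\ge0$ ($X^{\rm c}$: convex elements); $x$ is invertible if some $x'$ satisfies $x+x'=\theta$ ($x'$ unique, the inverse; $X^{\rm inv}$: invertible elements). An $L$-space is a semilinear space with a complete separable metric $h_X$ satisfying $h_X(\alpha x,\alpha y)=|\alpha|h_X(x,y)$ and $h_X(x+z,y+z)\le h_X(x,y)$; isotropic if the latter is always equality. $\theta$ denotes the zero of the relevant space. Modulus of continuity: non-decreasing continuous $\omega\colon[0,\infty)\to[0,\infty)$, $\omega(0)=0$, $\omega(a+b)\le\omega(a)+\omega(b)$; $H^\omega(T,X)=\{f\colon T\to X: h_X(f(s),f(t))\le\omega(r(s,t))\}$. $f\colon T\to X$ is measurable if $h_X(f(\cdot),x)$ is Borel measurable for all $x$; $B(T,X)$, $B(T,\mathbb R)$: bounded measurable functions. $(u\cdot x)(t)=u(t)x$, $(\chi f)(t)=\chi(t)f(t)$. For real $\xi$, $\xi_\pm=\max\{\pm\xi,0\}$, $u_\pm(t)=(u(t))_\pm$; for $u\colon T\to\mathbb R$ and $x\in X^{\rm inv}$, $u_x(t)=u_+(t)x+u_-(t)x'$. $\mathcal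 H(X,Y)$: maps $\lambda\colon X\to Y$ with $\lambda(\alpha x)=\alpha\lambda(x)$ ($\alpha\ge0$) and $h_Y(\lambda(x),\lambda(y))\le h_X(x,y)$. $\mathcal M(T)$: functionals $\varphi\colon B(T,\mathbb R)\to\mathbb R$ with $\varphi(u)\le\varphi(v)$ whenever $0\le u\le v$. $\mathcal L(\lambda,\varphi)$: operators $\Lambda\colon B(T,X)\to Y$ with $h_Y(\Lambda f,\Lambda g)\le\varphi(t\mapsto h_Y(\lambda(f(t)),\lambda(g(t))))$ for all $f,g$, and $\Lambda(u\cdot x)=\varphi(u)\lambda(x)$ for non-negative $u\in B(T,\mathbb R)$, $x\in X$. $\varphi$ is $\chi$-averaging if $\varphi(\chi)\ne0$ and for every non-negative $u\in B(T,\mathbb R)$ the function $\psi=u-\varphi(u\chi)/\varphi(\chi)$ satisfies $\varphi(\psi_+\chi)=\varphi(\psi_-\chi)$. A sequence $\{x_n\}\subset X$ is $\lambda$-extremal if $h_X(x_n,\theta)=1$ for all $n$ and $h_Y(\lambda(x_n),\theta)\to1$. *)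

theory Defs
  imports "HOL-Analysis.Analysis"
begin

text \<open>A semilinear space is represented on a whole type: addition, multiplication
by reals, the zero element theta, and the metric h.\<close>
record 'a slsp =
  sadd :: "'a \<Rightarrow> 'a \<Rightarrow> 'a"
  ssmul :: "real \<Rightarrow> 'a \<Rightarrow> 'a"
  szero :: 'a
  sdist :: "'a \<Rightarrow> 'a \<Rightarrow> real"

definition semilinear :: "'a slsp \<Rightarrow> bool" where
  "semilinear X \<longleftrightarrow>
     (\<forall>x y. sadd X x y = sadd X y x) \<and>
     (\<forall>x y z. sadd X x (sadd X y z) = sadd X (sadd X x y) z) \<and>
     (\<forall>x. sadd X x (szero X) = x) \<and>
     (\<forall>\<alpha> x y. ssmul X \<alpha> (sadd X x y) = sadd X (ssmul X \<alpha> x) (ssmul X \<alpha> y)) \<and>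
     (\<forall>\<alpha> \<beta> x. ssmul X \<alpha> (ssmul X \<beta> x) = ssmul X (\<alpha> * \<beta>) x) \<and>
     (\<forall>x. ssmul X 1 x = x) \<and>
     (\<forall>x. ssmul X 0 x = szero X)"

definition complete_separable_metric :: "('a \<Rightarrow> 'a \<Rightarrow> real) \<Rightarrow> bool" where
  "complete_separable_metric d \<longleftrightarrow>
     (\<forall>x y. d x y = 0 \<longleftrightarrow> x = y) \<and>
     (\<forall>x y. d x y = d y x) \<and>
     (\<forall>x y z. d x z \<le> d x y + d y z) \<and>
     (\<forall>s::nat \<Rightarrow> 'a. (\<forall>e>0. \<exists>N. \<forall>m\<ge>N. \<forall>n\<ge>N. d (s m) (s n) < e)
          \<longrightarrow> (\<exists>l. (\<lambda>n. d (s n) l) \<longlonglongrightarrow> 0)) \<and>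
     (\<exists>D. countable D \<and> (\<forall>x. \<forall>e>0. \<exists>y\<in>D. d x y < e))"

definition L_space :: "'a slsp \<Rightarrow> bool" where
  "L_space X \<longleftrightarrow> semilinear X \<and> complete_separable_metric (sdist X) \<and>
     (\<forall>\<alpha> x y. sdist X (ssmul X \<alpha> x) (ssmul X \<alpha> y) = \<bar>\<alpha>\<bar> * sdist X x y) \<and>
     (\<forall>x y z. sdist X (sadd X x z) (sadd X y z) \<le> sdist X x y)"

definition isotropic :: "'a slsp \<Rightarrow> bool" where
  "isotropic X \<longleftrightarrow> (\<forall>x y z. sdist X (sadd X x z) (sadd X y z) = sdist X x y)"

definition convex_el :: "'a slsp \<Rightarrow> 'a \<Rightarrow> bool" where
  "convex_el X x \<longleftrightarrow> (\<forall>\<alpha> \<beta>. \<alpha> \<ge> 0 \<longrightarrow> \<beta> \<ge> 0 \<longrightarrow>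
      ssmul X (\<alpha> + \<beta>) x = sadd X (ssmul X \<alpha> x) (ssmul X \<beta> x))"

definition invertible_el :: "'a slsp \<Rightarrow> 'a \<Rightarrow> bool" where
  "invertible_el X x \<longleftrightarrow> (\<exists>x'. sadd X x x' = szero X)"

definition sinv :: "'a slsp \<Rightarrow> 'a \<Rightarrow> 'a" where
  "sinv X x = (THE x'. sadd X x x' = szero X)"

definition modulus_of_continuity :: "(real \<Rightarrow> real) \<Rightarrow> bool" where
  "modulus_of_continuity \<omega> \<longleftrightarrow>
     mono_on {0..} \<omega> \<and> continuous_on {0..} \<omega> \<and> \<omega> 0 = 0 \<and>
     (\<forall>a\<ge>0. \<omega> a \<ge> 0) \<and>
     (\<forall>a b. a \<ge> 0 \<longrightarrow> b \<ge> 0 \<longrightarrow> \<omega> (a + b) \<le> \<omega> a + \<omega> b)"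

definition Hom :: "(real \<Rightarrow> real) \<Rightarrow> 'a slsp \<Rightarrow> ('t::metric_space \<Rightarrow> 'a) set" where
  "Hom \<omega> X = {f. \<forall>s t. sdist X (f s) (f t) \<le> \<omega> (dist s t)}"

definition meas_fun :: "'a slsp \<Rightarrow> ('t::topological_space \<Rightarrow> 'a) \<Rightarrow> bool" where
  "meas_fun X f \<longleftrightarrow> (\<forall>x. (\<lambda>t. sdist X (f t) x) \<in> borel_measurable borel)"

definition BX :: "'a slsp \<Rightarrow> ('t::topological_space \<Rightarrow> 'a) set" where
  "BX X = {f. meas_fun X f \<and> (\<exists>c. \<forall>t. sdist X (f t) (szero X) \<le> c)}"

definition BR :: "('t::topological_space \<Rightarrow> real) set" where
  "BR = {u. u \<in> borel_measurable borel \<and> bounded (range u)}"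

definition HXY :: "'a slsp \<Rightarrow> 'b slsp \<Rightarrow> ('a \<Rightarrow> 'b) set" where
  "HXY X Y = {l. (\<forall>\<alpha>\<ge>0. \<forall>x. l (ssmul X \<alpha> x) = ssmul Y \<alpha> (l x)) \<and>
                 (\<forall>x y. sdist Y (l x) (l y) \<le> sdist X x y)}"

definition MT :: "(('t::topological_space \<Rightarrow> real) \<Rightarrow> real) set" where
  "MT = {\<phi>. \<forall>u\<in>BR. \<forall>v\<in>BR. (\<forall>t. 0 \<le> u t \<and> u t \<le> v t) \<longrightarrow> \<phi> u \<le> \<phi> v}"

definition LL :: "'a slsp \<Rightarrow> 'b slsp \<Rightarrow> ('a \<Rightarrow> 'b) \<Rightarrow> (('t::topological_space \<Rightarrow> real) \<Rightarrow> real)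
    \<Rightarrow> (('t \<Rightarrow> 'a) \<Rightarrow> 'b) set" where
  "LL X Y l \<phi> = {\<Lambda>.
     (\<forall>f\<in>BX X. \<forall>g\<in>BX X. sdist Y (\<Lambda> f) (\<Lambda> g) \<le> \<phi> (\<lambda>t. sdist Y (l (f t)) (l (g t)))) \<and>
     (\<forall>u\<in>BR. \<forall>x. (\<forall>t. 0 \<le> u t) \<longrightarrow> \<Lambda> (\<lambda>t. ssmul X (u t) x) = ssmul Y (\<phi> u) (l x))}"

definition chi_averaging :: "(('t::topological_space \<Rightarrow> real) \<Rightarrow> real) \<Rightarrow> ('t \<Rightarrow> real) \<Rightarrow> bool" where
  "chi_averaging \<phi> chi \<longleftrightarrow> \<phi> chi \<noteq> 0 \<and>
     (\<forall>u\<in>BR. (\<forall>t. 0 \<le> u t) \<longrightarrow>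
        (let \<psi> = (\<lambda>t. u t - \<phi> (\<lambda>s. u s * chi s) / \<phi> chi)
         in \<phi> (\<lambda>t. max (\<psi> t) 0 * chi t) = \<phi> (\<lambda>t. max (- \<psi> t) 0 * chi t)))"

definition ufun :: "'a slsp \<Rightarrow> ('t \<Rightarrow> real) \<Rightarrow> 'a \<Rightarrow> 't \<Rightarrow> 'a" where
  "ufun X u x = (\<lambda>t. sadd X (ssmul X (max (u t) 0) x) (ssmul X (max (- u t) 0) (sinv X x)))"

definition Xtilde :: "'a slsp \<Rightarrow> 'b slsp \<Rightarrow> ('a \<Rightarrow> 'b) \<Rightarrow> 'a set" where
  "Xtilde X Y l = {x. invertible_el X x \<and> convex_el X x \<and>
      invertible_el Y (l x) \<and> convex_el Y (l x) \<and> l (sinv X x) = sinv Y (l x)}"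

definition lam_extremal :: "'a slsp \<Rightarrow> 'b slsp \<Rightarrow> ('a \<Rightarrow> 'b) \<Rightarrow> (nat \<Rightarrow> 'a) \<Rightarrow> bool" where
  "lam_extremal X Y l xs \<longleftrightarrow> (\<forall>n. sdist X (xs n) (szero X) = 1) \<and>
      (\<lambda>n. sdist Y (l (xs n)) (szero Y)) \<longlonglongrightarrow> 1"

end

theory Submission
  imports Defs
begin

text \<open>If \<open>\<Lambda> (\<chi> f) = \<theta>\<close>, then \<open>\<phi>(\<chi>) \<lambda>(f(t))\<close> is the value of \<open>\<Lambda>\<close> at \<open>\<chi> f(t)\<close>, and its distance
  to \<open>\<theta> = \<Lambda> (\<chi> f)\<close> is controlled by \<open>\<phi>\<close> of \<open>\<chi>(s) h(f(t), f(s)) \<le> \<chi>(s) \<omega>(r(t, s))\<close>; since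
  \<open>\<chi> f(t)\<close> may be non-measurable, \<open>\<chi>\<close> is first perturbed by a factor close to \<open>1\<close>.
  With \<open>\<psi> = \<omega>(r(t, \<cdot>)) - \<phi>(\<omega>(r(t, \<cdot>)) \<chi>) / \<phi>(\<chi>)\<close>, the functions \<open>\<psi>\<^sub>x\<close> for \<open>x\<close> in a
  \<open>\<lambda>\<close>-extremal sequence are annihilated after multiplication by \<open>\<chi>\<close> because \<open>\<phi>\<close> is
  \<open>\<chi>\<close>-averaging, and they show that the bound is attained in the limit.\<close>

section \<open>Elementary facts on $L$-spaces\<close>

lemma semilinearD:
  assumes "semilinear X"
  shows "sadd X x y = sadd X y x"
    and "sadd X x (sadd X y z) = sadd X (sadd X x y) z"
    and "sadd X x (szero X) = x"
    and "ssmul X a (sadd X x y) = sadd X (ssmul X a x) (ssmul X a y)"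
    and "ssmul X a (ssmul X b x) = ssmul X (a * b) x"
    and "ssmul X 1 x = x"
    and "ssmul X 0 x = szero X"
  using assms unfolding semilinear_def by blast+

lemma L_spaceD:
  assumes "L_space X"
  shows "semilinear X"
    and "sdist X x y = 0 \<longleftrightarrow> x = y"
    and "sdist X x y = sdist X y x"
    and "sdist X x z \<le> sdist X x y + sdist X y z"
    and "sdist X (ssmul X a x) (ssmul X a y) = \<bar>a\<bar> * sdist X x y"
    and "sdist X (sadd X x z) (sadd X y z) \<le> sdist X x y"
  using assms unfolding L_space_def complete_separable_metric_def by blast+

lemma L_space_countable_dense:
  assumes "L_space X"
  obtains d :: "nat \<Rightarrow> 'a" where "\<And>x e. e > 0 \<Longrightarrow> \<exists>n. sdist X x (d n) < e"
proof -
  have "\<exists>D. countable D \<and> (\<forall>x. \<forall>e>0. \<exists>y\<in>D. sdist X x y < e)"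
    using assms by (simp add: L_space_def complete_separable_metric_def)
  then obtain D where D: "countable D" "\<forall>x. \<forall>e>0. \<exists>y\<in>D. sdist X x y < e" by blast
  have "\<exists>n. sdist X x (from_nat_into D n) < e" if e: "e > 0" for x e
  proof -
    obtain y where y: "y \<in> D" "sdist X x y < e" using D(2) e by blast
    obtain n where "from_nat_into D n = y" using from_nat_into_surj[OF D(1) y(1)] ..
    with y(2) show ?thesis by blast
  qed
  then show ?thesis by (rule that)
qed

lemma sdist_self [simp]: "L_space X \<Longrightarrow> sdist X x x = 0"
  by (simp add: L_spaceD(2))

lemma sdist_nonneg: "L_space X \<Longrightarrow> 0 \<le> sdist X x y"
  using L_spaceD(4)[of X x x y] L_spaceD(3)[of X y x] by simp

lemma sdist_lipschitz2:
  assumes "L_space X"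
  shows "\<bar>sdist X x y - sdist X x' y'\<bar> \<le> sdist X x x' + sdist X y y'"
  using L_spaceD(4)[OF assms, of x y x'] L_spaceD(4)[OF assms, of x' y y']
    L_spaceD(4)[OF assms, of x' y' x] L_spaceD(4)[OF assms, of x y' y]
    L_spaceD(3)[OF assms, of x x'] L_spaceD(3)[OF assms, of y y'] by linarith

lemma ssmul_zero:
  assumes "semilinear X"
  shows "ssmul X a (szero X) = szero X"
  using semilinearD(5)[OF assms, of a 0] semilinearD(7)[OF assms] by (metis mult_zero_right)

lemma sdist_ssmul_zero:
  assumes "L_space X"
  shows "sdist X (ssmul X a x) (szero X) = \<bar>a\<bar> * sdist X x (szero X)"
  using L_spaceD(5)[OF assms, of a x "szero X"] ssmul_zero[OF L_spaceD(1)[OF assms]] by simp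

lemma sadd_zero_left: "semilinear X \<Longrightarrow> sadd X (szero X) x = x"
  by (metis semilinearD(1,3))

lemma sadd_ac:
  assumes "semilinear X"
  shows "sadd X (sadd X x y) z = sadd X x (sadd X y z)"
    and "sadd X x y = sadd X y x"
    and "sadd X x (sadd X y z) = sadd X y (sadd X x z)"
  using semilinearD(1,2)[OF assms] by metis+

section \<open>Invertible elements and their inverses\<close>

lemma inverse_el_unique:
  assumes "semilinear X" "sadd X x y = szero X" "sadd X x z = szero X"
  shows "y = z"
  using assms by (metis semilinearD(1,2,3))

lemma sadd_sinv:
  assumes "semilinear X" "invertible_el X x"
  shows "sadd X x (sinv X x) = szero X"
proof -
  obtain y where y: "sadd X x y = szero X" using assms(2) unfolding invertible_el_def by blast
  show ?thesis unfolding sinv_def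
    by (rule theI[of _ y]) (use y inverse_el_unique[OF assms(1)] in blast)+
qed

text \<open>Adding \<open>sinv X x\<close> carries the pair \<open>szero X\<close>, \<open>x\<close>
  to \<open>sinv X x\<close>, \<open>szero X\<close>, and adding \<open>x\<close> goes back.
  Translations do not increase distances, which gives both inequalities.\<close>

lemma sdist_sinv_zero:
  assumes "L_space X" "invertible_el X x"
  shows "sdist X (sinv X x) (szero X) = sdist X x (szero X)"
proof -
  note sl = L_spaceD(1)[OF assms(1)]
  note inv = sadd_sinv[OF sl assms(2)]
  have "sdist X (sinv X x) (szero X) \<le> sdist X x (szero X)"
    using L_spaceD(6)[OF assms(1), of "szero X" "sinv X x" x] inv
    by (simp add: sadd_zero_left[OF sl] L_spaceD(3)[OF assms(1)])
  moreover have "sdist X x (szero X) \<le> sdist X (sinv X x) (szero X)"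
    using L_spaceD(6)[OF assms(1), of "szero X" x "sinv X x"] inv
    by (metis L_spaceD(3) assms(1) sadd_zero_left semilinearD(1) sl)
  ultimately show ?thesis by simp
qed

text \<open>Both sides of the convexity identity for \<open>sinv X x\<close> are inverses of
  \<open>ssmul X (a + b) x\<close>, so uniqueness of inverses identifies them.\<close>

lemma convex_el_sinv:
  assumes sl: "semilinear X" and inv: "invertible_el X x" and cv: "convex_el X x"
  shows "convex_el X (sinv X x)"
  unfolding convex_el_def
proof (intro allI impI)
  fix a b :: real assume ab: "0 \<le> a" "0 \<le> b"
  note s = sadd_sinv[OF sl inv]
  have scal: "sadd X (ssmul X c x) (ssmul X c (sinv X x)) = szero X" for c
    using semilinearD(4)[OF sl, of c x "sinv X x"] s ssmul_zero[OF sl] by simp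
  have "sadd X (ssmul X (a + b) x) (sadd X (ssmul X a (sinv X x)) (ssmul X b (sinv X x)))
      = sadd X (sadd X (ssmul X a x) (ssmul X a (sinv X x)))
               (sadd X (ssmul X b x) (ssmul X b (sinv X x)))"
    using cv ab unfolding convex_el_def by (simp add: sadd_ac[OF sl])
  also have "\<dots> = szero X" by (simp add: scal semilinearD(3)[OF sl])
  finally show "ssmul X (a + b) (sinv X x) = sadd X (ssmul X a (sinv X x)) (ssmul X b (sinv X x))"
    using scal inverse_el_unique[OF sl] by blast
qed

section \<open>The functions \<open>ufun X u x\<close> for invertible convex
  \<open>x\<close>\<close>

text \<open>Convexity splits a multiple of \<open>x\<close> or of its inverse at the smaller
  coefficient, and opposite multiples cancel. The case split follows the signs of \<open>u q\<close>
  and \<open>u p\<close>. An increment of \<open>ufun X u x\<close> thus becomes one multiple of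
  \<open>x\<close>, from which the Lipschitz bound is read off.\<close>

lemma ufun_add:
  assumes sl: "semilinear X" and inv: "invertible_el X x" and cv: "convex_el X x"
    and le: "u q \<le> u p"
  shows "ufun X u x p = sadd X (ufun X u x q) (ssmul X (u p - u q) x)"
proof -
  note z = semilinearD(3)[OF sl] sadd_zero_left[OF sl] semilinearD(7)[OF sl]
  have scal: "sadd X (ssmul X c (sinv X x)) (ssmul X c x) = szero X" for c
    using semilinearD(4)[OF sl, of c "sinv X x" x] sadd_sinv[OF sl inv] ssmul_zero[OF sl]
      semilinearD(1)[OF sl] by simp
  have cx: "ssmul X (a + b) x = sadd X (ssmul X a x) (ssmul X b x)" if "0 \<le> a" "0 \<le> b" for a b
    using cv that unfolding convex_el_def by blast
  have cx': "ssmul X (a + b) (sinv X x) = sadd X (ssmul X a (sinv X x)) (ssmul X b (sinv X x))"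
    if "0 \<le> a" "0 \<le> b" for a b
    using convex_el_sinv[OF sl inv cv] that unfolding convex_el_def by blast
  consider "0 \<le> u q" | "u q < 0" "0 \<le> u p" | "u p < 0" by linarith
  then show ?thesis
  proof cases
    case 1
    then have "max (u q) 0 = u q" "max (- u q) 0 = 0" "max (u p) 0 = u p" "max (- u p) 0 = 0"
      using le by auto
    then show ?thesis using 1 cx[of "u q" "u p - u q"] le by (simp add: ufun_def z)
  next
    case 2
    then have "ssmul X (u p - u q) x = sadd X (ssmul X (- u q) x) (ssmul X (u p) x)"
      using cx[of "- u q" "u p"] by simp
    then show ?thesis using 2 scal by (simp add: ufun_def z max_def semilinearD(2)[OF sl])
  next
    case 3
    then have "ssmul X (- u q) (sinv X x)
        = sadd X (ssmul X (- u p) (sinv X x)) (ssmul X (u p - u q) (sinv X x))"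
      using cx'[of "- u p" "u p - u q"] le by simp
    then show ?thesis using 3 le scal
      by (simp add: ufun_def z max_def semilinearD(2)[OF sl, symmetric])
  qed
qed

lemma ufun_lipschitz:
  assumes L: "L_space X" and inv: "invertible_el X x" and cv: "convex_el X x"
  shows "sdist X (ufun X u x p) (ufun X u x q) \<le> \<bar>u p - u q\<bar> * sdist X x (szero X)"
proof -
  note sl = L_spaceD(1)[OF L]
  have *: "sdist X (ufun X u x p) (ufun X u x q) \<le> \<bar>u p - u q\<bar> * sdist X x (szero X)"
    if "u q \<le> u p" for p q
    using L_spaceD(6)[OF L, of "ssmul X (u p - u q) x" "ufun X u x q" "szero X"]
    unfolding ufun_add[where u = u, OF sl inv cv that] sadd_zero_left[OF sl] sdist_ssmul_zero[OF L]
      sadd_ac(2)[OF sl, of "ufun X u x q"] .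
  show ?thesis
  proof (cases "u q \<le> u p")
    case False
    then show ?thesis using *[of p q] by (metis L L_spaceD(3) abs_minus_commute nle_le)
  qed (rule *)
qed

text \<open>Non-negative factors commute with positive and negative parts. This brings a weighted
  \<open>ufun\<close> back to the form on which the value of \<open>\<Lambda>\<close> is
  prescribed.\<close>

lemma ssmul_ufun:
  assumes sl: "semilinear X" and "0 \<le> c s"
  shows "ssmul X (c s) (ufun X u x s) = ufun X (\<lambda>s. u s * c s) x s"
proof -
  have "c s * max (u s) 0 = max (u s * c s) 0" "c s * max (- u s) 0 = max (- (u s * c s)) 0"
    using assms(2) by (auto simp: max_def mult_le_0_iff zero_le_mult_iff mult.commute)
  then show ?thesis by (simp add: ufun_def semilinearD(4,5)[OF sl])
qed

section \<open>Bounded measurable functions\<close>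

lemma BR_times:
  assumes "u \<in> BR" "v \<in> BR"
  shows "(\<lambda>s. u s * v s) \<in> BR"
proof -
  obtain A B where "\<And>s. \<bar>u s\<bar> \<le> A" "\<And>s. \<bar>v s\<bar> \<le> B"
    using assms by (auto simp: BR_def bounded_iff)
  then have "\<bar>u s * v s\<bar> \<le> A * B" for s
    unfolding abs_mult by (intro mult_mono') auto
  moreover have "(\<lambda>s. u s * v s) \<in> borel_measurable borel"
    using assms by (simp add: BR_def borel_measurable_times)
  ultimately show ?thesis by (auto simp: BR_def bounded_iff)
qed

lemma BR_const: "(\<lambda>s. c) \<in> BR"
  by (auto simp: BR_def bounded_iff)

lemma BR_diff: "u \<in> BR \<Longrightarrow> v \<in> BR \<Longrightarrow> (\<lambda>s. u s - v s) \<in> BR"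
  unfolding BR_def by (auto intro: bounded_minus_comp)

lemma BR_continuous:
  fixes u :: "'t::metric_space \<Rightarrow> real"
  assumes "compact (UNIV :: 't set)" "continuous_on UNIV u"
  shows "u \<in> BR"
  using assms by (auto simp: BR_def borel_measurable_continuous_onI
      compact_continuous_image compact_imp_bounded)

lemma BR_dominated:
  assumes "u \<in> borel_measurable borel" "v \<in> BR" "\<And>s. \<bar>u s\<bar> \<le> v s"
  shows "u \<in> BR"
proof -
  obtain B where "\<And>s. \<bar>v s\<bar> \<le> B" using assms(2) by (auto simp: BR_def bounded_iff)
  then have "\<bar>u s\<bar> \<le> B" for s using assms(3)[of s] abs_ge_self[of "v s"] by (meson order_trans)
  then show ?thesis using assms(1) by (auto simp: BR_def bounded_iff)
qed

text \<open>The space \<open>X\<close> carries no type-class topology; measurability of the distance between two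
  measurable maps is obtained from an infimum over a countable dense set.\<close>

lemma borel_measurable_sdist_comp:
  assumes X: "L_space X" and Y: "L_space Y" and l: "l \<in> HXY X Y"
    and F: "meas_fun X F" and G: "meas_fun X G"
  shows "(\<lambda>s. sdist Y (l (F s)) (l (G s))) \<in> borel_measurable borel"
proof -
  obtain d where d: "\<And>x e. e > 0 \<Longrightarrow> \<exists>n::nat. sdist X x (d n) < e"
    using L_space_countable_dense[OF X] by blast
  define k where "k x y = sdist Y (l x) (l y)" for x y
  have klip: "\<bar>k x y - k x' y'\<bar> \<le> sdist X x x' + sdist X y y'" for x y x' y'
    using sdist_lipschitz2[OF Y, of "l x" "l y" "l x'" "l y'"] l unfolding k_def HXY_def
    by (smt (verit) mem_Collect_eq)
  \<comment> \<open>Strict sublevel sets become countable unions over pairs of net points.\<close>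
  have eq: "k (F s) (G s) < a \<longleftrightarrow>
      (\<exists>m n. k (d m) (d n) + sdist X (F s) (d m) + sdist X (G s) (d n) < a)" for s a
  proof
    assume a: "k (F s) (G s) < a"
    \<comment> \<open>The gap is split in four: each of the two approximations costs once through
      \<open>klip\<close> and once as an added summand.\<close>
    define e where "e = (a - k (F s) (G s)) / 4"
    have "e > 0" using a by (simp add: e_def)
    then obtain m n where mn: "sdist X (F s) (d m) < e" "sdist X (G s) (d n) < e" using d by meson
    show "\<exists>m n. k (d m) (d n) + sdist X (F s) (d m) + sdist X (G s) (d n) < a"
      using klip[of "F s" "G s" "d m" "d n"] mn a
      by (intro exI[of _ m] exI[of _ n]) (simp add: e_def abs_le_iff)
  next
    assume "\<exists>m n. k (d m) (d n) + sdist X (F s) (d m) + sdist X (G s) (d n) < a"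
    then show "k (F s) (G s) < a" using klip by (smt (verit))
  qed
  have [measurable]: "(\<lambda>s. sdist X (F s) z) \<in> borel_measurable borel"
    "(\<lambda>s. sdist X (G s) z) \<in> borel_measurable borel" for z
    using F G unfolding meas_fun_def by auto
  have "(\<lambda>s. k (F s) (G s)) \<in> borel_measurable borel"
    unfolding borel_measurable_iff_less eq by measurable
  then show ?thesis by (simp add: k_def)
qed

text \<open>The function factors as \<open>g\<close> after \<open>u\<close>, with \<open>g\<close> a
  Lipschitz curve on the real line. Its distances to fixed points are therefore continuous functions
  of \<open>u\<close>.\<close>

lemma ufun_BX:
  assumes L: "L_space X" and inv: "invertible_el X x" and cv: "convex_el X x" and u: "u \<in> BR"
  shows "ufun X u x \<in> BX X"
proof -
  define g where "g = ufun X (\<lambda>a::real. a) x"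
  have gu: "ufun X u x s = g (u s)" for s by (simp add: g_def ufun_def)
  have glip: "sdist X (g a) (g b) \<le> \<bar>a - b\<bar> * sdist X x (szero X)" for a b
    unfolding g_def using ufun_lipschitz[OF L inv cv, of "\<lambda>a. a"] by simp
  have g0: "g 0 = szero X"
    by (simp add: g_def ufun_def semilinearD(3,7)[OF L_spaceD(1)[OF L]])
  have "(sdist X x (szero X))-lipschitz_on UNIV (\<lambda>a. sdist X (g a) z)" for z
  proof (rule lipschitz_onI)
    fix a b
    have "\<bar>sdist X (g a) z - sdist X (g b) z\<bar> \<le> sdist X (g a) (g b)"
      using sdist_lipschitz2[OF L, of "g a" z "g b" z] L by simp
    also note glip
    finally show "dist (sdist X (g a) z) (sdist X (g b) z) \<le> sdist X x (szero X) * dist a b"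
      by (simp add: dist_real_def mult.commute)
  qed (rule sdist_nonneg[OF L])
  then have "(\<lambda>a. sdist X (g a) z) \<in> borel_measurable borel" for z
    by (intro borel_measurable_continuous_onI) (rule lipschitz_on_continuous_on)
  then have "meas_fun X (ufun X u x)"
    using u unfolding meas_fun_def gu BR_def by (auto intro: measurable_compose)
  moreover obtain B where "\<And>s. \<bar>u s\<bar> \<le> B" using u by (auto simp: BR_def bounded_iff)
  then have "sdist X (ufun X u x s) (szero X) \<le> B * sdist X x (szero X)" for s
    using glip[of "u s" 0] sdist_nonneg[OF L] unfolding gu g0
    by (smt (verit) mult_right_mono)
  ultimately show ?thesis unfolding BX_def by blast
qed

section \<open>Positivity and homogeneity of the majorant\<close>

lemma MT_mono:
  assumes "\<phi> \<in> MT" "u \<in> BR" "v \<in> BR" "\<And>s. 0 \<le> u s" "\<And>s. u s \<le> v s"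
  shows "\<phi> u \<le> \<phi> v"
  using assms unfolding MT_def by simp

lemma LL_lipschitz:
  assumes "\<Lambda> \<in> LL X Y l \<phi>" "f \<in> BX X" "g \<in> BX X"
  shows "sdist Y (\<Lambda> f) (\<Lambda> g) \<le> \<phi> (\<lambda>s. sdist Y (l (f s)) (l (g s)))"
  using assms by (simp add: LL_def)

lemma LL_ssmul:
  assumes "\<Lambda> \<in> LL X Y l \<phi>" "u \<in> BR" "\<And>s. 0 \<le> u s"
  shows "\<Lambda> (\<lambda>s. ssmul X (u s) x) = ssmul Y (\<phi> u) (l x)"
  using assms by (simp add: LL_def)

text \<open>\<open>MT\<close> only orders functionals on non-negative functions; the sign comes from
  the Lipschitz property of \<open>\<Lambda>\<close>, which for two equal functions gives 0 \<le>
  \<phi>(0).\<close>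

lemma LL_phi_nonneg:
  assumes X: "L_space X" and Y: "L_space Y" and phi: "\<phi> \<in> MT" and Lam: "\<Lambda> \<in> LL X Y l \<phi>"
    and u: "u \<in> BR" "\<And>s. 0 \<le> u s"
  shows "0 \<le> \<phi> u"
proof -
  have "(\<lambda>s. szero X) \<in> BX X" by (auto simp: BX_def meas_fun_def)
  then have "0 \<le> \<phi> (\<lambda>s. 0)"
    using LL_lipschitz[OF Lam, of "\<lambda>s. szero X" "\<lambda>s. szero X"] Y by simp
  also have "\<dots> \<le> \<phi> u" using MT_mono[OF phi BR_const u(1)] u(2) by simp
  finally show ?thesis .
qed

text \<open>The function with values \<open>(a * u s) x\<close> is also \<open>u s\<close> times the
  fixed element \<open>a x\<close>, so \<open>\<Lambda>\<close> can be evaluated on it in two ways.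
  Taking distances to zero and cancelling that of \<open>l x\<close>, which is positive by
  \<open>nz\<close>, leaves the claim for the non-negative values of \<phi>.\<close>

lemma LL_phi_homogeneous:
  assumes X: "L_space X" and Y: "L_space Y" and l: "l \<in> HXY X Y" and phi: "\<phi> \<in> MT"
    and Lam: "\<Lambda> \<in> LL X Y l \<phi>" and nz: "l x \<noteq> szero Y"
    and u: "u \<in> BR" "\<And>s. 0 \<le> u s" and a: "0 \<le> a"
  shows "\<phi> (\<lambda>s. a * u s) = a * \<phi> u"
proof -
  have au: "(\<lambda>s. a * u s) \<in> BR" using BR_times[OF BR_const u(1)] .
  have "ssmul Y (\<phi> (\<lambda>s. a * u s)) (l x) = \<Lambda> (\<lambda>s. ssmul X (a * u s) x)"
    using LL_ssmul[OF Lam au] u(2) a by simp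
  also have "\<dots> = \<Lambda> (\<lambda>s. ssmul X (u s) (ssmul X a x))"
    by (simp add: semilinearD(5)[OF L_spaceD(1)[OF X]] mult.commute)
  also have "\<dots> = ssmul Y (\<phi> u) (l (ssmul X a x))"
    by (rule LL_ssmul[OF Lam u])
  also have "\<dots> = ssmul Y (a * \<phi> u) (l x)"
    using l a unfolding HXY_def by (simp add: semilinearD(5)[OF L_spaceD(1)[OF Y]] mult.commute)
  finally have "\<bar>\<phi> (\<lambda>s. a * u s)\<bar> * sdist Y (l x) (szero Y) = \<bar>a * \<phi> u\<bar> * sdist Y (l x) (szero Y)"
    using sdist_ssmul_zero[OF Y] by metis
  then show ?thesis
    using nz L_spaceD(2)[OF Y] LL_phi_nonneg[OF X Y phi Lam au] LL_phi_nonneg[OF X Y phi Lam u] u a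
    by simp
qed

section \<open>The upper estimate\<close>

text \<open>Monotonicity and subadditivity carry the triangle inequality over to
  \<open>\<omega> (dist s s')\<close>. This is what puts the extremal functions into
  \<open>Hom \<omega> X\<close>.\<close>

lemma modulus_abs_diff_le:
  fixes s s' t :: "'t::metric_space"
  assumes "modulus_of_continuity \<omega>"
  shows "\<bar>\<omega> (dist t s) - \<omega> (dist t s')\<bar> \<le> \<omega> (dist s s')"
proof -
  have "\<omega> (dist t a) \<le> \<omega> (dist t b) + \<omega> (dist a b)" for a b
  proof -
    have "\<omega> (dist t a) \<le> \<omega> (dist t b + dist a b)"
      using assms dist_triangle2[of t a b] unfolding modulus_of_continuity_def
      by (auto elim!: mono_onD)
    also have "\<dots> \<le> \<omega> (dist t b) + \<omega> (dist a b)"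
      using assms unfolding modulus_of_continuity_def by auto
    finally show ?thesis .
  qed
  from this[of s s'] this[of s' s] show ?thesis by (simp add: dist_commute abs_le_iff)
qed

lemma modulus_dist_BR:
  fixes t :: "'t::metric_space"
  assumes "compact (UNIV :: 't set)" "modulus_of_continuity \<omega>"
  shows "(\<lambda>s. \<omega> (dist t s)) \<in> BR"
proof (rule BR_continuous[OF assms(1)])
  show "continuous_on UNIV (\<lambda>s. \<omega> (dist t s))"
  proof (rule continuous_on_compose2[of "{0..}" \<omega> UNIV "dist t"])
    show "continuous_on {0..} \<omega>" using assms(2) unfolding modulus_of_continuity_def by blast
    show "continuous_on UNIV (dist t)" by (intro continuous_intros)
  qed auto
qed

text \<open>Cells of width \<open>e\<close> on the logarithmic scale: numbers in one cell differ at
  most by the factor \<open>exp e\<close>.\<close>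

lemma le_exp_if_floor_ln_eq:
  fixes a b e :: real
  assumes "0 < a" "0 < b" "0 < e" "\<lfloor>ln a / e\<rfloor> = \<lfloor>ln b / e\<rfloor>"
  shows "a \<le> exp e * b"
proof -
  have "ln a / e < ln b / e + 1" using assms(4) by linarith
  then have "ln a < ln b + e" using assms(3) by (simp add: field_simps)
  then have "exp (ln a) \<le> exp (ln b + e)" by simp
  then show ?thesis using assms(1,2) by (simp add: exp_add mult.commute)
qed

text \<open>In an \<open>L\<close>-space the map \<open>\<alpha> \<mapsto> \<alpha> x\<close> need not be Borel measurable (twist the scalar
  multiplication of the complex numbers by a discontinuous character), so \<open>\<chi> x\<close> may fail to be
  measurable even if \<open>\<chi> f\<close> is. Here \<open>\<chi>\<close> is replaced by a function \<open>v\<close> that agrees with \<open>\<chi>\<close>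
  where \<open>w \<chi> = 0\<close> (there \<open>\<chi> f = \<chi> x\<close>) and elsewhere takes countably many values, each borrowed from a
  representative point at which \<open>\<chi>\<close>, \<open>w \<chi>\<close> and \<open>\<chi> f\<close> are almost the same.\<close>

lemma measurable_weight_approx:
  fixes chi w :: "'t::metric_space \<Rightarrow> real"
  assumes X: "L_space X"
    and chi: "chi \<in> BR" "\<And>s. 0 \<le> chi s" and w: "w \<in> BR" "\<And>s. 0 \<le> w s"
    and F: "(\<lambda>s. ssmul X (chi s) (f s)) \<in> BX X"
    and fx: "\<And>s. sdist X (f s) x \<le> w s" and e: "0 < e"
  obtains v where "v \<in> BR" "\<And>s. 0 \<le> v s" "(\<lambda>s. ssmul X (v s) x) \<in> BX X"
    "\<And>s. chi s \<le> exp e * v s"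
    "\<And>s. sdist X (ssmul X (v s) x) (ssmul X (chi s) (f s)) \<le> (e + e * exp e + exp e) * (w s * chi s)"
proof -
  define F where "F s = ssmul X (chi s) (f s)" for s
  define W where "W s = w s * chi s" for s
  have Wnn: "0 \<le> W s" for s using chi w by (simp add: W_def)
  have [measurable]: "chi \<in> borel_measurable borel" "w \<in> borel_measurable borel"
    using chi w unfolding BR_def by auto
  have [measurable]: "W \<in> borel_measurable borel" unfolding W_def by measurable
  have [measurable]: "(\<lambda>s. sdist X (F s) z) \<in> borel_measurable borel" for z
    using F unfolding BX_def meas_fun_def F_def by auto
  obtain d where d: "\<And>x e. e > 0 \<Longrightarrow> \<exists>n::nat. sdist X x (d n) < e"
    using L_space_countable_dense[OF X] by blast
  \<comment> \<open>The precision is relative to \<open>W s\<close>, so that all errors end up as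
    multiples of \<open>W\<close>; the value is meaningful only where
    \<open>W s > 0\<close>.\<close>
  define N where "N s = (LEAST n. sdist X (F s) (d n) < e * W s)" for s
  have [measurable]: "N \<in> measurable borel (count_space UNIV)"
    unfolding N_def by measurable
  have N: "sdist X (F s) (d (N s)) < e * W s" if "W s > 0" for s
    unfolding N_def by (rule LeastI_ex) (use d that e in simp)
  define I where "I s = (N s, \<lfloor>ln (chi s) / e\<rfloor>, \<lfloor>ln (W s) / e\<rfloor>)" for s
  \<comment> \<open>The cell index has countably many values, so \<open>g\<close> may be arbitrary.
    This allows the representatives below to be picked by choice.\<close>
  have I_meas: "(\<lambda>s. g (I s)) \<in> borel_measurable borel" for g :: "nat \<times> int \<times> int \<Rightarrow> real"
  proof -
    have 1: "(\<lambda>s. g (N s, j, k)) \<in> borel_measurable borel" for j k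
      by (rule measurable_compose[of N _ "count_space UNIV"]) auto
    have 2: "(\<lambda>s. g (N s, \<lfloor>ln (chi s) / e\<rfloor>, k)) \<in> borel_measurable borel" for k
      by (rule measurable_compose_countable[where f = "\<lambda>j s. g (N s, j, k)"]) (use 1 in measurable)
    show ?thesis unfolding I_def
      by (rule measurable_compose_countable[where f = "\<lambda>k s. g (N s, \<lfloor>ln (chi s) / e\<rfloor>, k)"])
        (use 2 in measurable)
  qed
  define rep where "rep i = (SOME s. W s > 0 \<and> I s = i)" for i
  have rep: "W (rep (I s)) > 0 \<and> I (rep (I s)) = I s" if "W s > 0" for s
    unfolding rep_def by (rule someI[of _ s]) (use that in simp)
  define v where "v s = (if W s > 0 then chi (rep (I s)) else chi s)" for s
  have chi_pos: "chi s > 0" if "W s > 0" for s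
    using that chi(2)[of s] unfolding W_def by (cases "chi s = 0") auto
  have cmp: "chi s \<le> exp e * v s \<and> v s \<le> exp e * chi s" for s
  proof (cases "W s > 0")
    case True
    have "chi s > 0" "chi (rep (I s)) > 0"
      "\<lfloor>ln (chi s) / e\<rfloor> = \<lfloor>ln (chi (rep (I s))) / e\<rfloor>"
      using chi_pos True rep[OF True] by (auto simp: I_def)
    then show ?thesis using le_exp_if_floor_ln_eq e True by (simp add: v_def)
  next
    case False
    have "1 * chi s \<le> exp e * chi s" using e chi(2) by (intro mult_right_mono) auto
    then show ?thesis using False by (simp add: v_def)
  qed
  have vnn: "0 \<le> v s" for s using chi(2) by (simp add: v_def)
  have v_meas: "v \<in> borel_measurable borel"
    unfolding v_def using I_meas[of "\<lambda>i. chi (rep i)"] by measurable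
  have vBR: "v \<in> BR"
    by (rule BR_dominated[OF v_meas BR_times[OF BR_const[of "exp e"] chi(1)]]) (use cmp vnn in simp)
  have deg: "ssmul X (v s) x = F s" if "\<not> W s > 0" for s
  proof -
    have "W s = 0" using that Wnn[of s] by simp
    then consider "w s = 0" | "chi s = 0" by (auto simp: W_def)
    then show ?thesis
    proof cases
      case 1
      then have "f s = x" using fx[of s] sdist_nonneg[OF X, of "f s" x] L_spaceD(2)[OF X] by simp
      then show ?thesis using that by (simp add: v_def F_def)
    next
      case 2
      then show ?thesis using that by (simp add: v_def F_def semilinearD(7)[OF L_spaceD(1)[OF X]])
    qed
  qed
  \<comment> \<open>Where \<open>W s > 0\<close> this is a function of the cell index; elsewhere
    \<open>deg\<close> turns it into the distance from the measurable \<open>F\<close>.\<close>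
  have "(\<lambda>s. sdist X (ssmul X (v s) x) z) \<in> borel_measurable borel" for z
  proof -
    have "(\<lambda>s. if W s > 0 then sdist X (ssmul X (chi (rep (I s))) x) z else sdist X (F s) z)
        \<in> borel_measurable borel"
      using I_meas[of "\<lambda>i. sdist X (ssmul X (chi (rep i)) x) z"] by measurable
    also have "(\<lambda>s. if W s > 0 then sdist X (ssmul X (chi (rep (I s))) x) z else sdist X (F s) z)
        = (\<lambda>s. sdist X (ssmul X (v s) x) z)"
      using deg by (auto simp: v_def)
    finally show ?thesis .
  qed
  moreover obtain B where "\<And>s. \<bar>v s\<bar> \<le> B" using vBR by (auto simp: BR_def bounded_iff)
  then have "sdist X (ssmul X (v s) x) (szero X) \<le> B * sdist X x (szero X)" for s
    unfolding sdist_ssmul_zero[OF X] using sdist_nonneg[OF X] by (intro mult_right_mono) auto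
  ultimately have vBX: "(\<lambda>s. ssmul X (v s) x) \<in> BX X" unfolding BX_def meas_fun_def by blast
  have est: "sdist X (ssmul X (v s) x) (F s) \<le> (e + e * exp e + exp e) * W s" for s
  proof (cases "W s > 0")
    case True
    \<comment> \<open>The path from \<open>v s\<close> times \<open>x\<close> to \<open>F s\<close>
      runs through \<open>F r\<close> and the net point \<open>d (N s)\<close> shared by
      \<open>r\<close> and \<open>s\<close>. The legs cost \<open>exp e\<close>,
      \<open>e * exp e\<close> and \<open>e\<close> times \<open>W s\<close>.\<close>
    define r where "r = rep (I s)"
    have r: "W r > 0" "N r = N s" "\<lfloor>ln (W r) / e\<rfloor> = \<lfloor>ln (W s) / e\<rfloor>"
      using rep[OF True] by (auto simp: I_def r_def)
    have Wr: "W r \<le> exp e * W s" using le_exp_if_floor_ln_eq[OF r(1) True e r(3)] .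
    have "sdist X (ssmul X (v s) x) (F r) = chi r * sdist X (f r) x"
      using True chi(2) by (simp add: v_def r_def[symmetric] F_def L_spaceD(5)[OF X] L_spaceD(3)[OF X, of x])
    also have "\<dots> \<le> W r" unfolding W_def using fx chi(2) by (simp add: mult.commute[of _ "chi r"] mult_left_mono)
    finally have 1: "sdist X (ssmul X (v s) x) (F r) \<le> exp e * W s" using Wr by simp
    have 2: "sdist X (F r) (d (N s)) \<le> e * exp e * W s"
    proof -
      have "sdist X (F r) (d (N s)) \<le> e * W r" using N[OF r(1)] r(2) by simp
      also have "\<dots> \<le> e * (exp e * W s)" by (rule mult_left_mono[OF Wr]) (use e in simp)
      finally show ?thesis by (simp add: mult.assoc)
    qed
    have 3: "sdist X (d (N s)) (F s) \<le> e * W s" using N[OF True] L_spaceD(3)[OF X] by (metis less_imp_le)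
    show ?thesis
      using 1 2 3 L_spaceD(4)[OF X, of "ssmul X (v s) x" "F s" "F r"]
        L_spaceD(4)[OF X, of "F r" "F s" "d (N s)"] by (simp add: distrib_right)
  next
    case False
    then show ?thesis using deg e Wnn[of s] X by simp
  qed
  show ?thesis
    by (rule that[OF vBR vnn vBX conjunct1[OF cmp] est[unfolded F_def W_def]])
qed

text \<open>With \<open>v\<close> from \<open>measurable_weight_approx\<close>, \<phi>(v) times
  \<open>l x\<close> is the value of \<open>\<Lambda>\<close> at \<open>v\<close> times
  \<open>x\<close>, and its distance to the annihilated value is at most \<phi> of an error close to
  \<open>w * chi\<close>. Homogeneity of \<phi> extracts the error factors, which tend to 1.\<close>

lemma sdist_le_of_annihilated:
  fixes \<phi> :: "('t::metric_space \<Rightarrow> real) \<Rightarrow> real"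
  assumes X: "L_space X" and Y: "L_space Y" and l: "l \<in> HXY X Y" and phi: "\<phi> \<in> MT"
    and chi: "chi \<in> BR" "\<And>s. 0 \<le> chi s" and Lam: "\<Lambda> \<in> LL X Y l \<phi>"
    and w: "w \<in> BR" "\<And>s. 0 \<le> w s" and fx: "\<And>s. sdist X (f s) x \<le> w s"
    and F: "(\<lambda>s. ssmul X (chi s) (f s)) \<in> BX X"
    and Lf: "\<Lambda> (\<lambda>s. ssmul X (chi s) (f s)) = szero Y"
  shows "\<phi> chi * sdist Y (l x) (szero Y) \<le> \<phi> (\<lambda>s. w s * chi s)"
\<comment> \<open>Homogeneity of \<phi> is available only for \<open>l x\<close> different from
  zero; otherwise the left side vanishes.\<close>
proof (cases "l x = szero Y")
  case True
  then show ?thesis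
    using LL_phi_nonneg[OF X Y phi Lam BR_times[OF w(1) chi(1)]] w chi Y by simp
next
  case False
  define c where "c = sdist Y (l x) (szero Y)"
  define W where "W s = w s * chi s" for s
  have W: "W \<in> BR" "0 \<le> W s" for s
    using BR_times[OF w(1) chi(1)] w chi by (auto simp: W_def[abs_def])
  note hom = LL_phi_homogeneous[OF X Y l phi Lam False]
  have bound: "\<phi> chi * c \<le> exp e * ((e + e * exp e + exp e) * \<phi> W)" if e: "e > 0" for e
  proof -
    obtain v where v: "v \<in> BR" "\<And>s. 0 \<le> v s" "(\<lambda>s. ssmul X (v s) x) \<in> BX X"
      "\<And>s. chi s \<le> exp e * v s"
      "\<And>s. sdist X (ssmul X (v s) x) (ssmul X (chi s) (f s)) \<le> (e + e * exp e + exp e) * W s"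
      using measurable_weight_approx[OF X chi w F fx e] unfolding W_def by blast
    define k where "k = e + e * exp e + exp e"
    have k: "0 \<le> k" using e by (simp add: k_def)
    define D where "D s = sdist Y (l (ssmul X (v s) x)) (l (ssmul X (chi s) (f s)))" for s
    have kW: "(\<lambda>s. k * W s) \<in> BR" using BR_times[OF BR_const W(1)] .
    have D: "0 \<le> D s" "D s \<le> k * W s" for s
    proof -
      show "0 \<le> D s" using sdist_nonneg[OF Y] by (simp add: D_def)
      have "D s \<le> sdist X (ssmul X (v s) x) (ssmul X (chi s) (f s))"
        using l unfolding D_def HXY_def by simp
      also have "\<dots> \<le> k * W s" unfolding k_def by (rule v(5))
      finally show "D s \<le> k * W s" .
    qed
    \<comment> \<open>\<open>MT\<close> compares only members of \<open>BR\<close>, so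
      \<open>D\<close> has to be measurable as well as dominated.\<close>
    have DBR: "D \<in> BR"
    proof (rule BR_dominated[OF _ kW])
      show "D \<in> borel_measurable borel"
        unfolding D_def using v(3) F by (intro borel_measurable_sdist_comp[OF X Y l]) (auto simp: BX_def)
    qed (use D in simp)
    have "\<phi> v * c = sdist Y (ssmul Y (\<phi> v) (l x)) (szero Y)"
      using LL_phi_nonneg[OF X Y phi Lam v(1,2)] by (simp add: sdist_ssmul_zero[OF Y] c_def)
    also have "\<dots> = sdist Y (\<Lambda> (\<lambda>s. ssmul X (v s) x)) (\<Lambda> (\<lambda>s. ssmul X (chi s) (f s)))"
      using LL_ssmul[OF Lam v(1,2)] Lf by simp
    also have "\<dots> \<le> \<phi> D" unfolding D_def by (rule LL_lipschitz[OF Lam v(3) F])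
    also have "\<dots> \<le> \<phi> (\<lambda>s. k * W s)" using MT_mono[OF phi DBR kW] D by simp
    also have "\<dots> = k * \<phi> W" using hom W k by blast
    finally have vc: "\<phi> v * c \<le> k * \<phi> W" .
    have "\<phi> chi \<le> \<phi> (\<lambda>s. exp e * v s)"
      using MT_mono[OF phi chi(1) BR_times[OF BR_const v(1)]] chi(2) v(4) by simp
    also have "\<dots> = exp e * \<phi> v" using hom v by simp
    finally have "\<phi> chi * c \<le> exp e * \<phi> v * c"
      using sdist_nonneg[OF Y] by (simp add: c_def mult_right_mono)
    also have "\<dots> \<le> exp e * (k * \<phi> W)" using vc by simp
    finally show ?thesis by (simp add: k_def)
  qed
  \<comment> \<open>Letting \<open>e\<close> decrease to 0 turns the factor in \<open>bound\<close>
    into 1.\<close>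
  have "((\<lambda>e. exp e * ((e + e * exp e + exp e) * \<phi> W)) \<longlongrightarrow> exp 0 * ((0 + 0 * exp 0 + exp 0) * \<phi> W))
      (at_right 0)"
    by (intro tendsto_intros)
  then have "\<phi> chi * c \<le> exp 0 * ((0 + 0 * exp 0 + exp 0) * \<phi> W)"
    by (rule tendsto_lowerbound) (auto simp: eventually_at_right_less bound intro: eventually_mono[OF eventually_at_right_less])
  then show ?thesis by (simp add: c_def W_def[abs_def])
qed

section \<open>Extremal functions\<close>

lemma extremal_function:
  fixes \<phi> :: "('t::metric_space \<Rightarrow> real) \<Rightarrow> real"
  assumes X: "L_space X" and Y: "L_space Y" and cpt: "compact (UNIV :: 't set)"
    and om: "modulus_of_continuity \<omega>" and l: "l \<in> HXY X Y"
    and chi: "chi \<in> BR" "\<And>s. 0 \<le> chi s"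
    and av: "chi_averaging \<phi> chi"
    and Lam: "\<And>u. u \<in> BR \<Longrightarrow> \<Lambda> (ufun X u x) = sadd Y (ssmul Y (\<phi> (\<lambda>s. max (u s) 0)) (l x))
                                      (ssmul Y (\<phi> (\<lambda>s. max (- u s) 0)) (l (sinv X x)))"
    and x: "x \<in> Xtilde X Y l" and x1: "sdist X x (szero X) = 1"
    and m: "m = \<phi> (\<lambda>s. \<omega> (dist t s) * chi s) / \<phi> chi" "0 \<le> m"
  obtains f where "f \<in> Hom \<omega> X" "(\<lambda>s. ssmul X (chi s) (f s)) \<in> BX X"
    "\<Lambda> (\<lambda>s. ssmul X (chi s) (f s)) = szero Y"
    "sdist Y (l (f t)) (szero Y) = m * sdist Y (l x) (szero Y)"
proof -
  note slX = L_spaceD(1)[OF X] and slY = L_spaceD(1)[OF Y]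
  have inv: "invertible_el X x" and cv: "convex_el X x" and invY: "invertible_el Y (l x)"
    and linv: "l (sinv X x) = sinv Y (l x)"
    using x unfolding Xtilde_def by auto
  define \<psi> where "\<psi> s = \<omega> (dist t s) - m" for s
  define f where "f = ufun X \<psi> x"
  have omBR: "(\<lambda>s. \<omega> (dist t s)) \<in> BR" using modulus_dist_BR[OF cpt om] .
  have om0: "\<omega> 0 = 0" "0 \<le> \<omega> (dist t s)" for s
    using om unfolding modulus_of_continuity_def by auto
  have psichi: "(\<lambda>s. \<psi> s * chi s) \<in> BR"
    using BR_times[OF BR_diff[OF omBR BR_const] chi(1)] by (simp add: \<psi>_def)
  have chif: "(\<lambda>s. ssmul X (chi s) (f s)) = ufun X (\<lambda>s. \<psi> s * chi s) x"
    using ssmul_ufun[where c = chi, OF slX chi(2)] by (simp add: f_def)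
  have "sdist X (f p) (f q) \<le> \<omega> (dist p q)" for p q
  proof -
    have "sdist X (f p) (f q) \<le> \<bar>\<omega> (dist t p) - \<omega> (dist t q)\<bar>"
      using ufun_lipschitz[OF X inv cv, of \<psi> p q] by (simp add: f_def x1 \<psi>_def)
    also have "\<dots> \<le> \<omega> (dist p q)" by (rule modulus_abs_diff_le[OF om])
    finally show ?thesis .
  qed
  then have "f \<in> Hom \<omega> X" by (simp add: Hom_def)
  moreover have "(\<lambda>s. ssmul X (chi s) (f s)) \<in> BX X"
    unfolding chif using ufun_BX[OF X inv cv psichi] .
  moreover have "\<Lambda> (\<lambda>s. ssmul X (chi s) (f s)) = szero Y"
  proof -
    have parts: "max (\<psi> s * chi s) 0 = max (\<psi> s) 0 * chi s"
      "max (- (\<psi> s * chi s)) 0 = max (- \<psi> s) 0 * chi s" for s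
      using chi(2)[of s] by (auto simp: max_def mult_le_0_iff zero_le_mult_iff)
    \<comment> \<open>Averaging is applied to \<open>\<omega> (dist t s)\<close>, whose weighted
      mean is \<open>m\<close>. Equal coefficients make the value of \<open>\<Lambda>\<close> a
      multiple of \<open>l x\<close> plus its inverse.\<close>
    have "\<phi> (\<lambda>s. max (\<psi> s) 0 * chi s) = \<phi> (\<lambda>s. max (- \<psi> s) 0 * chi s)"
      using bspec[OF conjunct2[OF av[unfolded chi_averaging_def Let_def]] omBR] om0
      by (simp add: \<psi>_def m(1))
    then have "\<Lambda> (\<lambda>s. ssmul X (chi s) (f s))
        = ssmul Y (\<phi> (\<lambda>s. max (\<psi> s) 0 * chi s)) (sadd Y (l x) (sinv Y (l x)))"
      unfolding chif Lam[OF psichi] parts linv semilinearD(4)[OF slY] by simp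
    then show ?thesis by (simp add: sadd_sinv[OF slY invY] ssmul_zero[OF slY])
  qed
  moreover have "sdist Y (l (f t)) (szero Y) = m * sdist Y (l x) (szero Y)"
  proof -
    \<comment> \<open>At \<open>t\<close> the modulus vanishes, so \<open>\<psi> t = - m\<close> and
      only the negative part survives.\<close>
    have "f t = ssmul X m (sinv X x)"
      using m(2) by (simp add: f_def ufun_def \<psi>_def om0 max_def semilinearD(7)[OF slX] sadd_zero_left[OF slX])
    then have "l (f t) = ssmul Y m (sinv Y (l x))"
      using l m(2) linv unfolding HXY_def by simp
    then show ?thesis using m(2) by (simp add: sdist_ssmul_zero[OF Y] sdist_sinv_zero[OF Y invY])
  qed
  ultimately show ?thesis using that by blast
qed

text \<open>Membership of the weighted function in \<open>BX X\<close> expresses that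
  \<open>\<Lambda>\<close> acts on bounded measurable functions. The supremum is formed in the
  extended reals, so it exists without a prior bound.\<close>

theorem theorem3:
  fixes X :: "'a slsp" and Y :: "'b slsp" and \<omega> :: "real \<Rightarrow> real"
    and l :: "'a \<Rightarrow> 'b" and \<phi> :: "('t::metric_space \<Rightarrow> real) \<Rightarrow> real"
    and chi :: "'t \<Rightarrow> real" and \<Lambda> :: "('t \<Rightarrow> 'a) \<Rightarrow> 'b" and t :: 't
  assumes "L_space X" and "L_space Y" and "compact (UNIV :: 't set)"
    and "modulus_of_continuity \<omega>" and "l \<in> HXY X Y" and "\<phi> \<in> MT"
    and "chi \<in> BR" and "\<forall>s. 0 \<le> chi s" and "\<phi> chi > 0" and "\<Lambda> \<in> LL X Y l \<phi>"
  shows "(SUP f \<in> {f \<in> Hom \<omega> X. (\<lambda>s. ssmul X (chi s) (f s)) \<in> BX X \<and>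
                    \<Lambda> (\<lambda>s. ssmul X (chi s) (f s)) = szero Y}.
            ereal (sdist Y (l (f t)) (szero Y)))
         \<le> ereal (\<phi> (\<lambda>s. \<omega> (dist t s) * chi s) / \<phi> chi) \<and>
        (isotropic X \<and> chi_averaging \<phi> chi \<and>
         (\<forall>x. convex_el X x \<and> invertible_el X x \<longrightarrow> (\<forall>u\<in>BR.
             \<Lambda> (ufun X u x) = sadd Y (ssmul Y (\<phi> (\<lambda>s. max (u s) 0)) (l x))
                                      (ssmul Y (\<phi> (\<lambda>s. max (- u s) 0)) (l (sinv X x))))) \<and>
         (\<exists>xs. (\<forall>n. xs n \<in> Xtilde X Y l) \<and> lam_extremal X Y l xs) \<longrightarrow>
         (SUP f \<in> {f \<in> Hom \<omega> X. (\<lambda>s. ssmul X (chi s) (f s)) \<in> BX X \<and>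
                    \<Lambda> (\<lambda>s. ssmul X (chi s) (f s)) = szero Y}.
            ereal (sdist Y (l (f t)) (szero Y)))
         = ereal (\<phi> (\<lambda>s. \<omega> (dist t s) * chi s) / \<phi> chi))"
proof -
  let ?A = "{f \<in> Hom \<omega> X. (\<lambda>s. ssmul X (chi s) (f s)) \<in> BX X \<and>
                    \<Lambda> (\<lambda>s. ssmul X (chi s) (f s)) = szero Y}"
  let ?S = "SUP f \<in> ?A. ereal (sdist Y (l (f t)) (szero Y))"
  define m where "m = \<phi> (\<lambda>s. \<omega> (dist t s) * chi s) / \<phi> chi"
  have chinn: "\<And>s. 0 \<le> chi s" using assms(8) by blast
  have omBR: "(\<lambda>s. \<omega> (dist t s)) \<in> BR" using modulus_dist_BR[OF assms(3,4)] .
  have omnn: "0 \<le> \<omega> (dist t s)" for s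
    using assms(4) unfolding modulus_of_continuity_def by auto
  have m0: "0 \<le> m"
    unfolding m_def using LL_phi_nonneg[OF assms(1,2,6,10) BR_times[OF omBR assms(7)]]
      omnn chinn assms(9) by simp
  have upper: "?S \<le> ereal m"
  proof (rule SUP_least)
    fix f assume f: "f \<in> ?A"
    \<comment> \<open>The annihilation estimate is used with the constant \<open>f t\<close> as
      \<open>x\<close> and \<open>\<omega> (dist t s)\<close> as \<open>w\<close>.\<close>
    have fx: "sdist X (f s) (f t) \<le> \<omega> (dist t s)" for s
      using f by (auto simp: Hom_def dist_commute)
    have "\<phi> chi * sdist Y (l (f t)) (szero Y) \<le> \<phi> (\<lambda>s. \<omega> (dist t s) * chi s)"
      using f by (intro sdist_le_of_annihilated[OF assms(1,2,5,6,7) chinn assms(10) omBR omnn fx]) auto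
    then show "ereal (sdist Y (l (f t)) (szero Y)) \<le> ereal m"
      using assms(9) by (simp add: m_def field_simps)
  qed
  have lower: "ereal m \<le> ?S"
    if av: "chi_averaging \<phi> chi"
      and Lam: "\<And>x u. convex_el X x \<and> invertible_el X x \<Longrightarrow> u \<in> BR \<Longrightarrow>
             \<Lambda> (ufun X u x) = sadd Y (ssmul Y (\<phi> (\<lambda>s. max (u s) 0)) (l x))
                                      (ssmul Y (\<phi> (\<lambda>s. max (- u s) 0)) (l (sinv X x)))"
      and xs: "\<And>n. xs n \<in> Xtilde X Y l" "lam_extremal X Y l xs" for xs
  proof (rule LIMSEQ_le_const2)
    \<comment> \<open>Each \<open>xs n\<close> yields an admissible function attaining the
      \<open>n\<close>-th term, and extremality sends these terms to \<open>m\<close>.\<close>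
    have "(\<lambda>n. m * sdist Y (l (xs n)) (szero Y)) \<longlonglongrightarrow> m * 1"
      using xs(2) unfolding lam_extremal_def by (intro tendsto_intros) blast
    then show "(\<lambda>n. ereal (m * sdist Y (l (xs n)) (szero Y))) \<longlonglongrightarrow> ereal m" by simp
    have "ereal (m * sdist Y (l (xs n)) (szero Y)) \<le> ?S" for n
    proof -
      have x1: "sdist X (xs n) (szero X) = 1" using xs(2) unfolding lam_extremal_def by blast
      have xc: "convex_el X (xs n) \<and> invertible_el X (xs n)"
        using xs(1)[of n] unfolding Xtilde_def by blast
      obtain f where f: "f \<in> Hom \<omega> X" "(\<lambda>s. ssmul X (chi s) (f s)) \<in> BX X"
        "\<Lambda> (\<lambda>s. ssmul X (chi s) (f s)) = szero Y"
        "sdist Y (l (f t)) (szero Y) = m * sdist Y (l (xs n)) (szero Y)"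
        by (rule extremal_function[OF assms(1-5,7) chinn av Lam[OF xc] xs(1) x1 m_def m0])
      have "f \<in> ?A" using f by simp
      then have "ereal (sdist Y (l (f t)) (szero Y)) \<le> ?S" by (rule SUP_upper)
      then show ?thesis by (simp only: f(4))
    qed
    then show "\<exists>N. \<forall>n\<ge>N. ereal (m * sdist Y (l (xs n)) (szero Y)) \<le> ?S" by blast
  qed
  show ?thesis
    unfolding m_def[symmetric]
  proof (intro conjI impI upper)
    assume H: "isotropic X \<and> chi_averaging \<phi> chi \<and>
         (\<forall>x. convex_el X x \<and> invertible_el X x \<longrightarrow> (\<forall>u\<in>BR.
             \<Lambda> (ufun X u x) = sadd Y (ssmul Y (\<phi> (\<lambda>s. max (u s) 0)) (l x))
                                      (ssmul Y (\<phi> (\<lambda>s. max (- u s) 0)) (l (sinv X x))))) \<and>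
         (\<exists>xs. (\<forall>n. xs n \<in> Xtilde X Y l) \<and> lam_extremal X Y l xs)"
    note av = conjunct1[OF conjunct2[OF H]]
    note Lam = conjunct1[OF conjunct2[OF conjunct2[OF H]]]
    obtain xs where xs: "\<And>n. xs n \<in> Xtilde X Y l" "lam_extremal X Y l xs"
      using conjunct2[OF conjunct2[OF conjunct2[OF H]]] by blast
    have "ereal m \<le> ?S"
      by (rule lower[OF av bspec[OF mp[OF spec[OF Lam]]] xs])
    then show "?S = ereal m" using upper by (rule antisym[rotated])
  qed
qed

end
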